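(* Let $\Sigma=\{\sigma_1,\ldots,\sigma_n\}$ be a semigroup of maps on $\{1,\ldots,N\}$ and let $V$ be a finite dimensional real vector space. Define for smooth $f,g:V^n\to V$ the function $$f\circ_\Sigma g:V^n\to V\quad\text{by}\quad f\circ_\Sigma g:=f\circ\big((g\circ A_{\sigma_1})\times\ldots\times(g\circ A_{\sigma_n})\big).$$ Then $\gamma_f\circ\gamma_g=\gamma_{f\circ_\Sigma g}$.
   Context: $N,n\ge 1$ are integers and $\Sigma=\{\sigma_1,\ldots,\sigma_n\}$ is a collection of $n$ distinct maps $\sigma_j:\{1,\ldots,N\}\to\{1,\ldots,N\}$. $\Sigma$ is called a semigroup if for all $1\le j_1,j_2\le n$ there is a unique $1\le j_3\le n$ with $\sigma_{j_1}\circ\sigma_{j_2}=\sigma_{j_3}$. In that case $\widetilde\sigma_j:\{1,\ldots,n\}\to\{1,\ldots,n\}$ is determined by $\sigma_{\widetilde\sigma_j(k)}=\sigma_j\circ\sigma_k$, and $A_{\sigma_j}:V^n\to V^n$ is the linear map $A_{\sigma_j}(X_1,\ldots,X_n)=(X_{\widetilde\sigma_1(j)},\ldots,X_{\widetilde\sigma_n(j)})$. The network map $\gamma_f:V^N\to V^N$ is $(\gamma_f)_i(x)=f(x_{\sigma_1(i)},\ldots,x_{\sigma_n(i)})$ for $1\le i\le N$. The notation $(g\circ A_{\sigma_1})\times\ldots\times(g\circ A_{\sigma_n})$ denotes the map $X\mapsto(g(A_{\sigma_1}X),\ldots,g(A_{\sigma_n}X))$ from $V^n$ to $V^n$. *)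

theory Defs
  imports "HOL-Analysis.Analysis"
begin

text \<open>
  The index sets \<open>{1, ..., N}\<close> and \<open>{1, ..., n}\<close> are the arbitrary finite types \<open>'N\<close> and \<open>'n\<close>
  (nonempty, so \<open>N, n \<ge> 1\<close>); \<open>V\<^sup>N\<close> and \<open>V\<^sup>n\<close> are \<open>'v ^ 'N\<close> and \<open>'v ^ 'n\<close>.  The type \<open>'v\<close> is a
  normed space rather than of class \<open>euclidean_space\<close> because the latter excludes the zero space;
  in finite dimension the choice of norm affects neither continuity nor differentiability.
\<close>

definition finite_dimensional :: "'v::real_vector itself \<Rightarrow> bool" where
  "finite_dimensional _ \<longleftrightarrow> (\<exists>B :: 'v set. finite B \<and> span B = UNIV)"

text \<open>
  On a finite dimensional domain, \<open>f\<close> is of class \<open>C\<^sup>k\<^sup>+\<^sup>1\<close> iff it is differentiable and all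
  directional derivatives \<open>x \<mapsto> D f(x) v\<close> are of class \<open>C\<^sup>k\<close>.
\<close>

primrec C_k :: "nat \<Rightarrow> ('a::real_normed_vector \<Rightarrow> 'b::real_normed_vector) \<Rightarrow> bool" where
  "C_k 0 f \<longleftrightarrow> continuous_on UNIV f"
| "C_k (Suc k) f \<longleftrightarrow>
     (\<forall>x. f differentiable (at x)) \<and> (\<forall>v. C_k k (\<lambda>x. frechet_derivative f (at x) v))"

definition smooth :: "('a::real_normed_vector \<Rightarrow> 'b::real_normed_vector) \<Rightarrow> bool" where
  "smooth f \<longleftrightarrow> (\<forall>k. C_k k f)"

definition is_semigroup :: "('n \<Rightarrow> 'N \<Rightarrow> 'N) \<Rightarrow> bool" where
  "is_semigroup \<sigma> \<longleftrightarrow> (\<forall>j\<^sub>1 j\<^sub>2. \<exists>!j\<^sub>3. \<sigma> j\<^sub>1 \<circ> \<sigma> j\<^sub>2 = \<sigma> j\<^sub>3)"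

definition sigma_tilde :: "('n \<Rightarrow> 'N \<Rightarrow> 'N) \<Rightarrow> 'n \<Rightarrow> 'n \<Rightarrow> 'n" where
  "sigma_tilde \<sigma> j k = (THE l. \<sigma> l = \<sigma> j \<circ> \<sigma> k)"

text \<open>In \<open>A_map \<sigma> j\<close> the index \<open>j\<close> is the argument of the maps \<open>sigma_tilde \<sigma> k\<close>, not their subscript.\<close>

definition A_map :: "('n::finite \<Rightarrow> 'N \<Rightarrow> 'N) \<Rightarrow> 'n \<Rightarrow> 'v ^ 'n \<Rightarrow> 'v ^ 'n" where
  "A_map \<sigma> j X = (\<chi> k. X $ sigma_tilde \<sigma> k j)"

definition network_map ::
    "('n::finite \<Rightarrow> 'N::finite \<Rightarrow> 'N) \<Rightarrow> ('v ^ 'n \<Rightarrow> 'v) \<Rightarrow> 'v ^ 'N \<Rightarrow> 'v ^ 'N" where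
  "network_map \<sigma> f x = (\<chi> i. f (\<chi> j. x $ \<sigma> j i))"

definition sigma_comp ::
    "('n::finite \<Rightarrow> 'N \<Rightarrow> 'N) \<Rightarrow> ('v ^ 'n \<Rightarrow> 'v) \<Rightarrow> ('v ^ 'n \<Rightarrow> 'v) \<Rightarrow> 'v ^ 'n \<Rightarrow> 'v" where
  "sigma_comp \<sigma> f g = f \<circ> (\<lambda>X. \<chi> j. (g \<circ> A_map \<sigma> j) X)"

end

theory Submission
  imports Defs
begin

text \<open>
  Cell \<open>i\<close> of the network with state \<open>x\<close> feels the input vector \<open>\<chi> j. x $ \<sigma> j i\<close>, whose \<open>j\<close>-th
  entry is the state of cell \<open>\<sigma> j i\<close>.  Composing network maps therefore requires the input vector of
  that other cell.  Since \<open>\<sigma> k \<circ> \<sigma> j\<close> again belongs to the semigroup, every entry of this vector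
  is an entry of the one at \<open>i\<close>, and which one it is depends only on \<open>j\<close> and \<open>k\<close>; \<open>A_map \<sigma> j\<close>
  makes this selection
  (lemma \<open>A_map_input_vector\<close>).  Hence the response at \<open>i\<close> of the composed maps is a function of the
  input vector at \<open>i\<close>, the same for all \<open>i\<close>, and that function is \<open>sigma_comp \<sigma> f g\<close>.
\<close>

lemma sigma_sigma_tilde:
  assumes "is_semigroup \<sigma>"
  shows "\<sigma> (sigma_tilde \<sigma> j k) = \<sigma> j \<circ> \<sigma> k"
proof -
  have "\<exists>!l. \<sigma> l = \<sigma> j \<circ> \<sigma> k"
    using assms unfolding is_semigroup_def by metis
  then show ?thesis
    unfolding sigma_tilde_def by (rule theI')
qed

text \<open>
  On input vectors \<open>A_map \<sigma> j\<close> transports cell \<open>i\<close> to cell \<open>\<sigma> j i\<close>.  The index \<open>j\<close> has to be the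
  argument of \<open>sigma_tilde \<sigma> k\<close>, because \<open>\<sigma> j\<close> is applied to \<open>i\<close> before \<open>\<sigma> k\<close>.
\<close>

lemma A_map_input_vector:
  assumes "is_semigroup \<sigma>"
  shows "A_map \<sigma> j (\<chi> k. x $ \<sigma> k i) = (\<chi> k. x $ \<sigma> k (\<sigma> j i))"
  by (simp add: A_map_def sigma_sigma_tilde[OF assms])

theorem theorem4p2:
  fixes \<sigma> :: "'n::finite \<Rightarrow> 'N::finite \<Rightarrow> 'N"
    and f g :: "'v::real_normed_vector ^ 'n \<Rightarrow> 'v"
  assumes "finite_dimensional TYPE('v)"
    and "inj \<sigma>"
    and "is_semigroup \<sigma>"
    and "smooth f"
    and "smooth g"
  shows "network_map \<sigma> f \<circ> network_map \<sigma> g = network_map \<sigma> (sigma_comp \<sigma> f g)"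
  by (simp add: fun_eq_iff network_map_def sigma_comp_def
      A_map_input_vector[OF \<open>is_semigroup \<sigma>\<close>])

end
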